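(* Let $G^k_n$ be the Manturov $(k,n)$-group for integers $n>k\ge 1$. Then: (i) for all $n>1$, $G^1_n$ has growth equal to $0$; (ii) $G^2_3$ has growth equal to $2$, and $G^2_3$ is a finite extension of $\mathbb{Z}^2$ (i.e., contains a subgroup of finite index isomorphic to $\mathbb{Z}^2$); (iii) for all $n>k\ge 3$, $G^k_n$ contains a free subgroup of rank $2$, and consequently has exponential growth (in particular $\operatorname{GKdim}(\mathbb{F}G^k_n)=\infty$ for every field $\mathbb{F}$).
   Context: For integers $n>k\ge1$, let $I^k_n$ be the set of $k$-element subsets of $\{1,\dots,n\}$. The Manturov $(k,n)$-group $G^k_n$ is the group with generators $a_m$, $m\in I^k_n$, and relations: (1) $a_m^2=1$ for all $m\in I^k_n$; (2) $a_ma_{m'}=a_{m'}a_m$ for all $m,m'\in I^k_n$ with $|m\cap m'|<k-1$; (3) for every sequence $(u_1,\dots,u_{k+1})$ of distinct elements of $\{1,\dots,n\}$, letting $U=\{u_1,\dots,u_{k+1}\}$ and $m^j=U\setminus\{u_j\}$, the relation $a_{m^1}a_{m^2}\cdots a_{m^{k+1}}=a_{m^{k+1}}\cdots a_{m^2}a_{m^1}$. A group $G$ has growth equal to a real number $d$ if the group algebra $\mathbb{F}G$ has Gelfand–Kirillov dimension $d$. *)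

theory Defs
  imports Complex_Main "HOL-Algebra.Algebra" "HOL-Library.Function_Algebras"
    "HOL-Library.Extended_Real" "HOL-Library.Liminf_Limsup"
begin

text \<open>Generators a_m are indexed by the k-element subsets m of {1..n}.
 Group elements are equivalence classes of words (lists of generators);
 since every generator is an involution (relation (1)), every group element
 is represented by a positive word, and the group is the quotient of the
 free monoid on the generators by the congruence generated by (1)-(3).\<close>

definition Isub :: "nat \<Rightarrow> nat \<Rightarrow> nat set set" where
  "Isub k n = {m. m \<subseteq> {1..n} \<and> card m = k}"

inductive manturov_rel :: "nat \<Rightarrow> nat \<Rightarrow> nat set list \<Rightarrow> nat set list \<Rightarrow> bool"
  for k n where
  inv: "m \<in> Isub k n \<Longrightarrow> manturov_rel k n [m, m] []"
| comm: "m \<in> Isub k n \<Longrightarrow> m' \<in> Isub k n \<Longrightarrow> card (m \<inter> m') < k - 1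
          \<Longrightarrow> manturov_rel k n [m, m'] [m', m]"
| tetra: "length u = k + 1 \<Longrightarrow> distinct u \<Longrightarrow> set u \<subseteq> {1..n}
          \<Longrightarrow> manturov_rel k n (map (\<lambda>j. set u - {u ! j}) [0..<k+1])
                                (rev (map (\<lambda>j. set u - {u ! j}) [0..<k+1]))"

inductive manturov_eq :: "nat \<Rightarrow> nat \<Rightarrow> nat set list \<Rightarrow> nat set list \<Rightarrow> bool"
  for k n where
  refl: "set w \<subseteq> Isub k n \<Longrightarrow> manturov_eq k n w w"
| sym: "manturov_eq k n v w \<Longrightarrow> manturov_eq k n w v"
| trans: "manturov_eq k n u v \<Longrightarrow> manturov_eq k n v w \<Longrightarrow> manturov_eq k n u w"
| step: "manturov_rel k n l r \<Longrightarrow> set xs \<subseteq> Isub k n \<Longrightarrow> set ys \<subseteq> Isub k n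
          \<Longrightarrow> manturov_eq k n (xs @ l @ ys) (xs @ r @ ys)"

definition word_class :: "nat \<Rightarrow> nat \<Rightarrow> nat set list \<Rightarrow> nat set list set" where
  "word_class k n w = {v. manturov_eq k n w v}"

definition Manturov_group :: "nat \<Rightarrow> nat \<Rightarrow> nat set list set monoid" where
  "Manturov_group k n =
     \<lparr> carrier = word_class k n ` {w. set w \<subseteq> Isub k n},
       monoid.mult = (\<lambda>A B. \<Union>a\<in>A. \<Union>b\<in>B. word_class k n (a @ b)),
       one = word_class k n [] \<rparr>"

definition group_algebra :: "('g, 'm) monoid_scheme \<Rightarrow> ('g \<Rightarrow> 'f::field) set" where
  "group_algebra G = {f. finite {x. f x \<noteq> 0} \<and> (\<forall>x. x \<notin> carrier G \<longrightarrow> f x = 0)}"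

definition ga_mult :: "('g, 'm) monoid_scheme \<Rightarrow> ('g \<Rightarrow> 'f::field) \<Rightarrow> ('g \<Rightarrow> 'f) \<Rightarrow> ('g \<Rightarrow> 'f)" where
  "ga_mult G f g = (\<lambda>x. if x \<in> carrier G then
      (\<Sum>a\<in>{a\<in>carrier G. f a \<noteq> 0}. f a * g (inv\<^bsub>G\<^esub> a \<otimes>\<^bsub>G\<^esub> x)) else 0)"

definition ga_one :: "('g, 'm) monoid_scheme \<Rightarrow> ('g \<Rightarrow> 'f::field)" where
  "ga_one G = (\<lambda>x. if x = \<one>\<^bsub>G\<^esub> then 1 else 0)"

definition ga_scale :: "'f::field \<Rightarrow> ('g \<Rightarrow> 'f) \<Rightarrow> ('g \<Rightarrow> 'f)" where
  "ga_scale c f = (\<lambda>x. c * f x)"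

text \<open>ga_pow G B n is the set of n-fold products of elements of B; its linear
  span is V^n where V = span B.\<close>
fun ga_pow :: "('g, 'm) monoid_scheme \<Rightarrow> ('g \<Rightarrow> 'f::field) set \<Rightarrow> nat \<Rightarrow> ('g \<Rightarrow> 'f) set" where
  "ga_pow G B 0 = {ga_one G}"
| "ga_pow G B (Suc n) = {ga_mult G p b | p b. p \<in> ga_pow G B n \<and> b \<in> B}"

text \<open>GKdim(A) = sup over finite-dimensional subspaces V of A containing 1
  of limsup_n log dim(V^n) / log n.  V is given by a finite spanning set B.\<close>
definition GKdim_group_algebra ::
  "'f::field itself \<Rightarrow> ('g, 'm) monoid_scheme \<Rightarrow> ereal" where
  "GKdim_group_algebra F G =
     (SUP B \<in> {B :: ('g \<Rightarrow> 'f) set. finite B \<and> B \<subseteq> group_algebra G \<and> ga_one G \<in> B}.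
        limsup (\<lambda>n. ereal (ln (real (vector_space.dim ga_scale (ga_pow G B n))) / ln (real n))))"

definition has_growth :: "'f::field itself \<Rightarrow> ('g, 'm) monoid_scheme \<Rightarrow> real \<Rightarrow> bool" where
  "has_growth F G d \<longleftrightarrow> GKdim_group_algebra F G = ereal d"

definition word_ball :: "('g, 'm) monoid_scheme \<Rightarrow> 'g set \<Rightarrow> nat \<Rightarrow> 'g set" where
  "word_ball G S r = {foldr (\<otimes>\<^bsub>G\<^esub>) ws \<one>\<^bsub>G\<^esub> | ws.
       length ws \<le> r \<and> set ws \<subseteq> S \<union> (\<lambda>s. inv\<^bsub>G\<^esub> s) ` S}"

definition exponential_growth :: "('g, 'm) monoid_scheme \<Rightarrow> bool" where
  "exponential_growth G \<longleftrightarrow>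
     (\<exists>S. finite S \<and> S \<subseteq> carrier G \<and> generate G S = carrier G \<and>
       (\<exists>c::real. c > 1 \<and> (\<forall>r. c ^ r \<le> real (card (word_ball G S r)))))"

text \<open>Letters of the free group on two generators: (second generator?, inverse?).\<close>
definition free_reduced :: "(bool \<times> bool) list \<Rightarrow> bool" where
  "free_reduced w \<longleftrightarrow> (\<forall>i. Suc i < length w \<longrightarrow>
      \<not> (fst (w ! i) = fst (w ! Suc i) \<and> snd (w ! i) \<noteq> snd (w ! Suc i)))"

definition eval_letter :: "('g, 'm) monoid_scheme \<Rightarrow> 'g \<Rightarrow> 'g \<Rightarrow> bool \<times> bool \<Rightarrow> 'g" where
  "eval_letter G x y l = (let g = (if fst l then y else x) in if snd l then inv\<^bsub>G\<^esub> g else g)"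

definition has_free_subgroup_rank2 :: "('g, 'm) monoid_scheme \<Rightarrow> bool" where
  "has_free_subgroup_rank2 G \<longleftrightarrow>
     (\<exists>x\<in>carrier G. \<exists>y\<in>carrier G. \<forall>w. w \<noteq> [] \<and> free_reduced w \<longrightarrow>
        foldr (\<otimes>\<^bsub>G\<^esub>) (map (eval_letter G x y) w) \<one>\<^bsub>G\<^esub> \<noteq> \<one>\<^bsub>G\<^esub>)"

definition virtually_Z2 :: "('g, 'm) monoid_scheme \<Rightarrow> bool" where
  "virtually_Z2 G \<longleftrightarrow>
     (\<exists>H. subgroup H G \<and> finite (rcosets\<^bsub>G\<^esub> H) \<and>
          G\<lparr>carrier := H\<rparr> \<cong> DirProd integer_group integer_group)"

end

theory Submission
  imports Defs "HOL-Real_Asymp.Real_Asymp" "HOL-Library.Product_Plus"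
begin

text \<open>For k = 1 the relations (3) make the involutive generators commute, so the group is finite.
  For (k, n) = (2, 3) the generators can be realised as three point reflections of the lattice
  \<int> \<times> \<int>, and the relations suffice to write every element as a translation times a power of one
  fixed reflection.  For k \<ge> 3, keep only the generators indexed by {1..k+1} - {j} with j \<le> 4: the
  first three go to the involutions of the Klein four-group, the fourth to a group of order two, and
  all others to 1.  Since the product of the three involutions of the Klein group is trivial in any
  order, all relations hold in the free product of the two groups, where free subgroups abound.\<close>

subsection \<open>The group presented by words\<close>

text \<open>Rewriting words proves elements equal; proving them different needs an invariant. No
  target group is constructed for this: words act by composing explicit maps on lattice points or
  lists, and only the relations have to be checked. For k \<ge> 3 write V for the Klein group and t
  for the generator of the group of order two. Relation (3) on {1..k+1} becomes ptq = qtp, where p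
  and q in V are the products on the two sides of t; their own reversal is harmless because V is
  abelian. Since pq = 1 in V, p = q and the two sides agree. This needs three indices besides that
  of t, hence k + 1 \<ge> 4. The free pair lives in the kernel of the projection of the free product
  of V and {1, t} onto V. This kernel is the free product of the four conjugates vtv of t, and
  (vtv)t and (wtw)t, with v and w distinct and nontrivial, generate a free group of rank two in it.
  The lists are words in the four conjugates, and conjugation by V permutes their letters.\<close>

lemma finite_Isub: "finite (Isub k n)"
  by (rule finite_subset[of _ "Pow {1..n}"]) (auto simp: Isub_def)

lemma manturov_rel_Isub:
  assumes "manturov_rel k n l r"
  shows "set l \<subseteq> Isub k n \<and> set r \<subseteq> Isub k n"
  using assms
proof cases
  case (tetra u)
  have "set u - {u ! j} \<in> Isub k n" if "j < k + 1" for j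
    using tetra that by (auto simp: Isub_def distinct_card)
  then show ?thesis
    unfolding tetra set_rev set_map set_upt by auto
qed auto

lemma manturov_eq_Isub:
  assumes "manturov_eq k n v w"
  shows "set v \<subseteq> Isub k n \<and> set w \<subseteq> Isub k n"
  using assms by induction (auto dest: manturov_rel_Isub)

lemma manturov_eq_append:
  assumes "manturov_eq k n v w" "set xs \<subseteq> Isub k n" "set ys \<subseteq> Isub k n"
  shows "manturov_eq k n (xs @ v @ ys) (xs @ w @ ys)"
  using assms(1)
proof induction
  case (refl w)
  then show ?case
    using assms by (intro manturov_eq.refl) auto
next
  case (step l r as bs)
  then have "manturov_eq k n ((xs @ as) @ l @ (bs @ ys)) ((xs @ as) @ r @ (bs @ ys))"
    using assms by (intro manturov_eq.step) auto
  then show ?case by simp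
qed (blast intro: manturov_eq.sym manturov_eq.trans)+

lemma manturov_eq_append2:
  assumes "manturov_eq k n v v'" "manturov_eq k n w w'"
  shows "manturov_eq k n (v @ w) (v' @ w')"
proof (rule manturov_eq.trans)
  show "manturov_eq k n (v @ w) (v' @ w)"
    using manturov_eq_append[OF assms(1), of "[]" w] manturov_eq_Isub[OF assms(2)] by simp
  show "manturov_eq k n (v' @ w) (v' @ w')"
    using manturov_eq_append[OF assms(2), of v' "[]"] manturov_eq_Isub[OF assms(1)] by simp
qed

lemma manturov_eq_rel: "manturov_rel k n l r \<Longrightarrow> manturov_eq k n l r"
  using manturov_eq.step[of k n l r "[]" "[]"] by simp

text \<open>Generators are involutions, so the reversed word represents the inverse; the pair in the
  middle cancels first.\<close>

lemma manturov_eq_rev_cancel: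
  assumes "set w \<subseteq> Isub k n"
  shows "manturov_eq k n (rev w @ w) []"
  using assms
proof (induction w)
  case Nil
  then show ?case by (simp add: manturov_eq.refl)
next
  case (Cons m w)
  then have "manturov_eq k n (rev w @ [m, m] @ w) (rev w @ [] @ w)"
    by (intro manturov_eq.step manturov_rel.inv) auto
  with Cons show ?case
    by (auto intro: manturov_eq.trans)
qed

lemma word_class_eq_iff:
  assumes "set w \<subseteq> Isub k n"
  shows "word_class k n v = word_class k n w \<longleftrightarrow> manturov_eq k n v w"
proof
  assume "word_class k n v = word_class k n w"
  moreover have "w \<in> word_class k n w"
    using assms by (simp add: word_class_def manturov_eq.refl)
  ultimately show "manturov_eq k n v w"
    by (simp add: word_class_def set_eq_iff)
next
  assume "manturov_eq k n v w"
  then show "word_class k n v = word_class k n w"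
    unfolding word_class_def by (blast intro: manturov_eq.sym manturov_eq.trans)
qed

lemma word_class_in_carrier:
  "set w \<subseteq> Isub k n \<Longrightarrow> word_class k n w \<in> carrier (Manturov_group k n)"
  by (simp add: Manturov_group_def)

lemma Manturov_carrierE:
  assumes "g \<in> carrier (Manturov_group k n)"
  obtains w where "set w \<subseteq> Isub k n" "g = word_class k n w"
  using assms by (auto simp: Manturov_group_def)

lemma one_Manturov: "\<one>\<^bsub>Manturov_group k n\<^esub> = word_class k n []"
  by (simp add: Manturov_group_def)

text \<open>The product is encoded as a union over all pairs of representatives. The classes in it
  all coincide, since equivalence is compatible with concatenation, and reflexivity supplies at
  least one pair.\<close>

lemma word_class_mult:
  assumes "set v \<subseteq> Isub k n" "set w \<subseteq> Isub k n"
  shows "word_class k n v \<otimes>\<^bsub>Manturov_group k n\<^esub> word_class k n w = word_class k n (v @ w)"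
proof -
  have "word_class k n (a @ b) = word_class k n (v @ w)"
    if "a \<in> word_class k n v" "b \<in> word_class k n w" for a b
    using that assms unfolding word_class_def[of _ _ v] word_class_def[of _ _ w]
    by (subst word_class_eq_iff) (auto intro!: manturov_eq_append2 intro: manturov_eq.sym)
  moreover have "v \<in> word_class k n v" "w \<in> word_class k n w"
    using assms by (auto simp: word_class_def manturov_eq.refl)
  ultimately show ?thesis
    unfolding Manturov_group_def monoid.simps by blast
qed

lemma group_Manturov: "group (Manturov_group k n)"
proof (rule groupI)
  show "\<one>\<^bsub>Manturov_group k n\<^esub> \<in> carrier (Manturov_group k n)"
    by (simp add: one_Manturov word_class_in_carrier)
next
  fix x assume "x \<in> carrier (Manturov_group k n)"
  then obtain w where w: "set w \<subseteq> Isub k n" "x = word_class k n w"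
    by (rule Manturov_carrierE)
  then show "\<one>\<^bsub>Manturov_group k n\<^esub> \<otimes>\<^bsub>Manturov_group k n\<^esub> x = x"
    by (simp add: one_Manturov word_class_mult)
  have "word_class k n (rev w) \<otimes>\<^bsub>Manturov_group k n\<^esub> x = \<one>\<^bsub>Manturov_group k n\<^esub>"
    using w by (simp add: word_class_mult one_Manturov word_class_eq_iff manturov_eq_rev_cancel)
  then show "\<exists>y\<in>carrier (Manturov_group k n). y \<otimes>\<^bsub>Manturov_group k n\<^esub> x = \<one>\<^bsub>Manturov_group k n\<^esub>"
    using w by (intro bexI[of _ "word_class k n (rev w)"]) (auto simp: word_class_in_carrier)
qed (auto elim!: Manturov_carrierE simp: word_class_mult word_class_in_carrier)

lemma inv_word_class:
  assumes "set w \<subseteq> Isub k n"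
  shows "inv\<^bsub>Manturov_group k n\<^esub> (word_class k n w) = word_class k n (rev w)"
proof (rule group.inv_equality[OF group_Manturov])
  show "word_class k n (rev w) \<otimes>\<^bsub>Manturov_group k n\<^esub> word_class k n w = \<one>\<^bsub>Manturov_group k n\<^esub>"
    using assms by (simp add: word_class_mult one_Manturov word_class_eq_iff manturov_eq_rev_cancel)
qed (use assms in \<open>simp_all add: word_class_in_carrier\<close>)

lemma foldr_word_class:
  assumes "\<And>v. v \<in> set vs \<Longrightarrow> set v \<subseteq> Isub k n"
  shows "foldr (\<otimes>\<^bsub>Manturov_group k n\<^esub>) (map (word_class k n) vs) \<one>\<^bsub>Manturov_group k n\<^esub>
    = word_class k n (concat vs)"
  using assms
proof (induction vs)
  case (Cons v vs)
  then have "set (concat vs) \<subseteq> Isub k n" by auto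
  with Cons show ?case by (simp add: word_class_mult)
qed (simp add: one_Manturov)

lemma Manturov_generated:
  "generate (Manturov_group k n) ((\<lambda>m. word_class k n [m]) ` Isub k n) = carrier (Manturov_group k n)"
  (is "generate ?G ?S = _")
proof
  show "generate ?G ?S \<subseteq> carrier ?G"
    by (intro group.generate_incl[OF group_Manturov]) (auto intro: word_class_in_carrier)
  have "word_class k n w \<in> generate ?G ?S" if "set w \<subseteq> Isub k n" for w
    using that
  proof (induction w)
    case Nil
    then show ?case by (simp add: generate.one flip: one_Manturov)
  next
    case (Cons m w)
    then have "word_class k n [m] \<otimes>\<^bsub>?G\<^esub> word_class k n w \<in> generate ?G ?S"
      by (intro generate.eng) (auto intro: generate.incl)
    with Cons show ?case by (simp add: word_class_mult)
  qed
  then show "carrier ?G \<subseteq> generate ?G ?S"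
    by (auto elim: Manturov_carrierE)
qed

text \<open>The criterion for telling elements apart: an action of the letters that respects each
  relation is constant on classes, composition of maps taking care of the contexts.\<close>

lemma foldr_eq_if_manturov_eq:
  assumes rel: "\<And>l r. manturov_rel k n l r \<Longrightarrow> foldr \<phi> l = foldr \<phi> r"
    and "manturov_eq k n v w"
  shows "foldr \<phi> v = foldr \<phi> w"
  using assms(2) by induction (simp_all add: rel foldr_append)

text \<open>Relation (3) equates a word with its reversal, so it holds under any action by commuting
  maps.\<close>

lemma foldr_rev_if_commute:
  assumes "\<And>x y. x \<in> set xs \<Longrightarrow> y \<in> set xs \<Longrightarrow> f y \<circ> f x = f x \<circ> f y"
  shows "foldr f (rev xs) = foldr f xs"
  using fold_rev[of xs f] foldr_fold[of xs f] assms by (simp add: foldr_conv_fold)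

lemma map_diff_nth:
  "length u = l \<Longrightarrow> map (\<lambda>j. f (u ! j)) [0..<l] = map f u"
  by (metis map_map map_nth comp_def map_cong)

subsection \<open>Growth and Gelfand--Kirillov dimension\<close>

interpretation ga: vector_space "ga_scale :: 'f::field \<Rightarrow> ('g \<Rightarrow> 'f) \<Rightarrow> 'g \<Rightarrow> 'f"
  by unfold_locales (auto simp: ga_scale_def algebra_simps fun_eq_iff)

definition ga_delta :: "'g \<Rightarrow> 'g \<Rightarrow> 'f::field" where
  "ga_delta g = (\<lambda>x. if x = g then 1 else 0)"

lemma ga_one_eq_delta: "ga_one G = ga_delta \<one>\<^bsub>G\<^esub>"
  by (simp add: ga_one_def ga_delta_def)

lemma ga_delta_in_group_algebra: "g \<in> carrier G \<Longrightarrow> ga_delta g \<in> group_algebra G"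
  by (auto simp: group_algebra_def ga_delta_def)

lemma inj_ga_delta: "inj_on (ga_delta :: 'g \<Rightarrow> 'g \<Rightarrow> 'f::field) A"
  by (rule inj_onI) (metis ga_delta_def zero_neq_one)

lemma sum_ga_delta:
  assumes "finite T"
  shows "(\<Sum>g\<in>T. ga_scale (c g) (ga_delta g)) = (\<lambda>x. if x \<in> T then c x else (0 :: 'f::field))"
proof
  fix x
  have "(\<Sum>g\<in>T. ga_scale (c g) (ga_delta g)) x = (\<Sum>g\<in>T. if x = g then c g else 0)"
    by (induction T rule: infinite_finite_induct) (auto simp: ga_scale_def ga_delta_def)
  then show "(\<Sum>g\<in>T. ga_scale (c g) (ga_delta g)) x = (if x \<in> T then c x else 0)"
    using assms by simp
qed

lemma dim_le_card_support:
  assumes "finite T" "\<And>f x. f \<in> P \<Longrightarrow> f x \<noteq> 0 \<Longrightarrow> x \<in> T"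
  shows "ga.dim (P :: ('g \<Rightarrow> 'f::field) set) \<le> card T"
proof -
  have "f \<in> ga.span (ga_delta ` T)" if "f \<in> P" for f
  proof -
    have "f = (\<Sum>g\<in>T. ga_scale (f g) (ga_delta g))"
      unfolding sum_ga_delta[OF assms(1)] by (rule ext) (use assms(2)[OF that] in metis)
    also have "\<dots> \<in> ga.span (ga_delta ` T)"
      by (intro ga.span_sum ga.span_scale ga.span_base) auto
    finally show ?thesis .
  qed
  then have "ga.dim P \<le> card ((ga_delta :: 'g \<Rightarrow> 'g \<Rightarrow> 'f) ` T)"
    using assms(1) by (intro ga.dim_le_card) auto
  also have "\<dots> = card T"
    by (rule card_image[OF inj_ga_delta])
  finally show ?thesis .
qed

text \<open>Deltas are independent, so counting group elements bounds a dimension from below.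
  Finiteness of \<open>P\<close> gives the finite basis that the exchange bound requires.\<close>

lemma card_le_dim_if_delta:
  assumes "finite P" "ga_delta ` T \<subseteq> (P :: ('g \<Rightarrow> 'f::field) set)"
  shows "card T \<le> ga.dim P"
proof -
  let ?D = "(ga_delta :: 'g \<Rightarrow> 'g \<Rightarrow> 'f) ` T"
  have T: "finite T"
    using assms finite_subset finite_imageD inj_ga_delta by metis
  have "ga.independent ?D"
  proof (rule ga.independent_if_scalars_zero)
    fix c :: "('g \<Rightarrow> 'f) \<Rightarrow> 'f" and f
    assume eq: "(\<Sum>f\<in>?D. ga_scale (c f) f) = 0" and "f \<in> ?D"
    then obtain g where g: "g \<in> T" "f = ga_delta g" by blast
    have "(\<Sum>g\<in>T. ga_scale (c (ga_delta g)) (ga_delta g)) = (\<Sum>f\<in>?D. ga_scale (c f) f)"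
      by (simp add: sum.reindex[OF inj_ga_delta])
    then have "(\<lambda>x. if x \<in> T then c (ga_delta x) else 0) = (0 :: 'g \<Rightarrow> 'f)"
      unfolding sum_ga_delta[OF T] eq .
    then show "c f = 0"
      using g by (auto dest!: fun_cong[of _ _ g])
  qed (use T in auto)
  moreover obtain B where B: "B \<subseteq> P" "P \<subseteq> ga.span B" "card B = ga.dim P"
    using ga.basis_exists[of P] by metis
  ultimately have "card ?D \<le> card B"
    using assms finite_subset[of B P] by (intro ga.independent_span_bound[THEN conjunct2]) auto
  then show ?thesis
    using B by (simp add: card_image[OF inj_ga_delta])
qed

lemma (in group) ga_mult_delta:
  assumes "g \<in> carrier G" "h \<in> carrier G"
  shows "ga_mult G (ga_delta g) (ga_delta h) = (ga_delta (g \<otimes> h) :: 'a \<Rightarrow> 'f::field)"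
proof
  fix x
  have *: "{a \<in> carrier G. ga_delta g a \<noteq> (0 :: 'f)} = {g}"
    using assms by (auto simp: ga_delta_def)
  have "inv g \<otimes> x = h \<longleftrightarrow> x = g \<otimes> h" if "x \<in> carrier G"
    using assms that inv_solve_left'[of h g x] by auto
  then show "ga_mult G (ga_delta g) (ga_delta h) x = (ga_delta (g \<otimes> h) x :: 'f)"
    using assms unfolding ga_mult_def * by (auto simp: ga_delta_def)
qed

lemma (in group) ga_mult_support:
  assumes "f \<in> group_algebra G" "ga_mult G f h x \<noteq> 0"
  obtains a b where "a \<in> carrier G" "b \<in> carrier G" "f a \<noteq> 0" "h b \<noteq> 0" "x = a \<otimes> b"
proof -
  have x: "x \<in> carrier G"
    using assms by (auto simp: ga_mult_def split: if_splits)
  have "(\<Sum>a\<in>{a \<in> carrier G. f a \<noteq> 0}. f a * h (inv a \<otimes> x)) \<noteq> 0"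
    using assms x by (simp add: ga_mult_def)
  then obtain a where "a \<in> carrier G" "f a \<noteq> 0" "h (inv a \<otimes> x) \<noteq> 0"
    by (rule sum.not_neutral_contains_not_neutral) auto
  with x that[of a "inv a \<otimes> x"] show thesis
    by (simp add: m_assoc[symmetric])
qed

lemma finite_ga_pow: "finite B \<Longrightarrow> finite (ga_pow G B n)"
proof (induction n)
  case (Suc n)
  have "ga_pow G B (Suc n) = (\<lambda>(p, b). ga_mult G p b) ` (ga_pow G B n \<times> B)"
    by auto
  with Suc show ?case by simp
qed simp

text \<open>A product with all supports in balls of a subadditive length function has its support in
  a ball of proportional radius, so the growth of the balls bounds the dimension.\<close>

lemma (in group) GKdim_le_if_length_function:
  fixes len :: "'a \<Rightarrow> nat" and d :: nat
  assumes one: "len \<one> = 0"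
    and mult: "\<And>g h. g \<in> carrier G \<Longrightarrow> h \<in> carrier G \<Longrightarrow> len (g \<otimes> h) \<le> len g + len h"
    and ball: "\<And>r. finite {g \<in> carrier G. len g \<le> r}"
      "\<And>r. card {g \<in> carrier G. len g \<le> r} \<le> C * (r + 1) ^ d"
  shows "GKdim_group_algebra (F :: 'f::field itself) G \<le> ereal d"
  unfolding GKdim_group_algebra_def
proof (rule SUP_least, clarify)
  fix B :: "('a \<Rightarrow> 'f) set"
  assume B: "finite B" "B \<subseteq> group_algebra G"
  define S where "S = (\<Union>f\<in>B. {x. f x \<noteq> 0})"
  have S: "finite S" "S \<subseteq> carrier G"
    using B by (auto simp: S_def group_algebra_def)
  define N where "N = Max (insert 0 (len ` S))"
  have N: "len x \<le> N" if "x \<in> S" for x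
    using S that by (auto simp: N_def intro!: Max_ge)
  have supp: "x \<in> carrier G \<and> len x \<le> n * N" if "f \<in> ga_pow G B n" "f x \<noteq> 0" for f x n
    using that
  proof (induction n arbitrary: f x)
    case 0
    then show ?case by (auto simp: ga_one_def one split: if_splits)
  next
    case (Suc n)
    then obtain p b where pb: "p \<in> ga_pow G B n" "b \<in> B" "f = ga_mult G p b" by auto
    have "{y. p y \<noteq> 0} \<subseteq> {g \<in> carrier G. len g \<le> n * N}"
      using Suc.IH pb by blast
    then have "p \<in> group_algebra G"
      using ball(1) finite_subset by (fastforce simp: group_algebra_def)
    then obtain y z where yz: "y \<in> carrier G" "z \<in> carrier G" "p y \<noteq> 0" "b z \<noteq> 0" "x = y \<otimes> z"
      using Suc.prems pb ga_mult_support by metis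
    then have "len y \<le> n * N" "len z \<le> N"
      using Suc.IH pb N by (auto simp: S_def)
    with yz mult[of y z] show ?case by simp
  qed
  \<comment> \<open>\<open>C + 1\<close> keeps \<open>K\<close> at least 1 even for C = 0, and
    \<open>N + 1\<close> absorbs the summand 1 through nN + 1 \<le> (N + 1)n for n \<ge> 1.\<close>
  define K where "K = real ((C + 1) * (N + 1) ^ d)"
  have "1 \<le> (C + 1) * (N + 1) ^ d"
    by (simp add: Suc_le_eq)
  then have K: "K \<ge> 1"
    unfolding K_def by (metis of_nat_1 of_nat_le_iff)
  have le: "ln (real (ga.dim (ga_pow G B n))) / ln (real n) \<le> (ln K + d * ln (real n)) / ln (real n)"
    if n: "n > 1" for n
  proof -
    have "ga.dim (ga_pow G B n) \<le> card {g \<in> carrier G. len g \<le> n * N}"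
      using ball(1) supp by (intro dim_le_card_support) auto
    also have "\<dots> \<le> C * (n * N + 1) ^ d"
      by (rule ball(2))
    also have "\<dots> \<le> (C + 1) * ((N + 1) * n) ^ d"
      using n by (intro mult_mono power_mono) auto
    also have "\<dots> = (C + 1) * (N + 1) ^ d * n ^ d"
      by (simp only: power_mult_distrib mult.assoc)
    finally have "real (ga.dim (ga_pow G B n)) \<le> K * real n ^ d"
      unfolding K_def by (metis of_nat_le_iff of_nat_mult of_nat_power)
    \<comment> \<open>The bound by 1 covers dimension 0, where the logarithm takes its default value
      \<open>ln 0 = 0\<close>.\<close>
    moreover have "K * real n ^ d \<ge> 1"
      using K n mult_mono[of 1 K 1 "real n ^ d"] by simp
    ultimately have "ln (real (ga.dim (ga_pow G B n))) \<le> ln (K * real n ^ d)"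
      by (cases "ga.dim (ga_pow G B n) = 0") auto
    also have "\<dots> = ln K + d * ln (real n)"
      using K n by (simp add: ln_mult ln_realpow)
    finally show ?thesis
      using n by (intro divide_right_mono) auto
  qed
  have "(\<lambda>n. (ln K + d * ln (real n)) / ln (real n)) \<longlonglongrightarrow> d"
    by real_asymp
  then have "limsup (\<lambda>n. ereal ((ln K + d * ln (real n)) / ln (real n))) = ereal d"
    by (intro lim_imp_Limsup) auto
  moreover have "limsup (\<lambda>n. ereal (ln (real (ga.dim (ga_pow G B n))) / ln (real n)))
      \<le> limsup (\<lambda>n. ereal ((ln K + d * ln (real n)) / ln (real n)))"
    by (intro Limsup_mono eventually_mono[OF eventually_gt_at_top[of 1]]) (use le in simp)
  ultimately show "limsup (\<lambda>n. ereal (ln (real (ga.dim (ga_pow G B n))) / ln (real n))) \<le> ereal d"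
    by simp
qed

section \<open>Word balls as lower bounds for the dimension\<close>

lemma (in group) foldr_mult_closed:
  "set ws \<subseteq> carrier G \<Longrightarrow> foldr (\<otimes>) ws \<one> \<in> carrier G"
  by (induction ws) auto

lemma (in group) foldr_mult_append:
  "set vs \<subseteq> carrier G \<Longrightarrow> set ws \<subseteq> carrier G \<Longrightarrow>
    foldr (\<otimes>) (vs @ ws) \<one> = foldr (\<otimes>) vs \<one> \<otimes> foldr (\<otimes>) ws \<one>"
  by (induction vs) (auto simp: m_assoc foldr_mult_closed)

lemma finite_word_ball:
  assumes "finite S"
  shows "finite (word_ball G S r)"
proof -
  have "word_ball G S r = (\<lambda>ws. foldr (\<otimes>\<^bsub>G\<^esub>) ws \<one>\<^bsub>G\<^esub>) `
      {ws. set ws \<subseteq> S \<union> (\<lambda>s. inv\<^bsub>G\<^esub> s) ` S \<and> length ws \<le> r}"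
    by (auto simp: word_ball_def)
  then show ?thesis
    using assms by (simp add: finite_lists_length_le)
qed

lemma ln_of_nat_mono: "a \<le> b \<Longrightarrow> ln (real a) \<le> ln (real b)"
proof (cases "a = 0")
  case True
  then show ?thesis by (cases b) simp_all
qed simp

text \<open>The test space is spanned by the deltas at the identity and at \<open>S\<close> with its
  inverses. Its n-fold products contain the delta of every ball element, the identity serving as
  padding for shorter words.\<close>

lemma (in group) limsup_word_ball_le_GKdim:
  assumes S: "finite S" "S \<subseteq> carrier G"
  shows "limsup (\<lambda>n. ereal (ln (real (card (word_ball G S n))) / ln (real n)))
    \<le> GKdim_group_algebra (F :: 'f::field itself) G"
proof -
  define S' where "S' = S \<union> (\<lambda>s. inv s) ` S"
  define B :: "('a \<Rightarrow> 'f) set" where "B = ga_delta ` insert \<one> S'"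
  have S': "finite S'" "S' \<subseteq> carrier G"
    using S by (auto simp: S'_def)
  have B: "finite B" "B \<subseteq> group_algebra G" "ga_one G \<in> B"
    using S' by (auto simp: B_def ga_one_eq_delta intro!: ga_delta_in_group_algebra)
  have pow: "ga_delta (foldr (\<otimes>) ws \<one>) \<in> ga_pow G B n" if "set ws \<subseteq> S'" "length ws \<le> n" for ws n
    using that
  proof (induction n arbitrary: ws)
    case 0
    then show ?case by (simp add: ga_one_eq_delta)
  next
    case (Suc n)
    \<comment> \<open>\<open>ga_pow\<close> adds factors on the right, so the last letter is split
      off; the empty word takes the identity as its extra factor.\<close>
    obtain vs s where vs: "set vs \<subseteq> S'" "length vs \<le> n" "s \<in> insert \<one> S'"
      "foldr (\<otimes>) ws \<one> = foldr (\<otimes>) vs \<one> \<otimes> s"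
    proof (cases ws rule: rev_cases)
      case Nil
      then show thesis using that[of "[]" \<one>] by simp
    next
      case (snoc vs s)
      then have *: "set vs \<subseteq> S'" "length vs \<le> n" "s \<in> S'"
        using Suc.prems by auto
      then have "foldr (\<otimes>) ws \<one> = foldr (\<otimes>) vs \<one> \<otimes> s"
        using S' snoc foldr_mult_append[of vs "[s]"] by force
      with * show thesis
        using that[of vs s] by simp
    qed
    then have "ga_delta (foldr (\<otimes>) ws \<one>) = ga_mult G (ga_delta (foldr (\<otimes>) vs \<one>)) (ga_delta s :: 'a \<Rightarrow> 'f)"
      using S' by (subst ga_mult_delta) (auto intro!: foldr_mult_closed)
    then show ?case
      using Suc.IH[OF vs(1,2)] vs(3) by (auto simp: B_def)
  qed
  have le: "ln (real (card (word_ball G S n))) / ln (real n) \<le> ln (real (ga.dim (ga_pow G B n))) / ln (real n)"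
    if n: "n > 1" for n
  proof -
    have "ga_delta ` word_ball G S n \<subseteq> ga_pow G B n"
      using pow by (auto simp: word_ball_def S'_def)
    then have "card (word_ball G S n) \<le> ga.dim (ga_pow G B n)"
      by (intro card_le_dim_if_delta finite_ga_pow B)
    then have "ln (real (card (word_ball G S n))) \<le> ln (real (ga.dim (ga_pow G B n)))"
      by (rule ln_of_nat_mono)
    then show ?thesis
      using n by (intro divide_right_mono) auto
  qed
  have "limsup (\<lambda>n. ereal (ln (real (card (word_ball G S n))) / ln (real n)))
      \<le> limsup (\<lambda>n. ereal (ln (real (ga.dim (ga_pow G B n))) / ln (real n)))"
    by (intro Limsup_mono eventually_mono[OF eventually_gt_at_top[of 1]]) (use le in simp)
  also have "\<dots> \<le> GKdim_group_algebra F G"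
    unfolding GKdim_group_algebra_def by (rule SUP_upper) (use B in simp)
  finally show ?thesis .
qed

lemma (in group) GKdim_infinite_if_exponential_growth:
  assumes "exponential_growth G"
  shows "GKdim_group_algebra (F :: 'f::field itself) G = \<infinity>"
proof -
  obtain S c where S: "finite S" "S \<subseteq> carrier G" and c: "c > 1"
    and growth: "\<And>r. c ^ r \<le> real (card (word_ball G S r))"
    using assms unfolding exponential_growth_def by blast
  have "filterlim (\<lambda>n. real n * ln c / ln (real n)) at_top sequentially"
    using c by real_asymp
  then have "(\<lambda>n. ereal (real n * ln c / ln (real n))) \<longlonglongrightarrow> \<infinity>"
    by (simp add: tendsto_PInfty_eq_at_top)
  then have "\<infinity> = limsup (\<lambda>n. ereal (real n * ln c / ln (real n)))"
    by (intro lim_imp_Limsup[symmetric]) auto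
  also have "\<dots> \<le> limsup (\<lambda>n. ereal (ln (real (card (word_ball G S n))) / ln (real n)))"
  proof (intro Limsup_mono eventually_mono[OF eventually_gt_at_top[of 1]])
    fix n :: nat assume n: "n > 1"
    have "ln (c ^ n) \<le> ln (real (card (word_ball G S n)))"
      using growth[of n] c by (intro ln_mono) auto
    with n c show "ereal (real n * ln c / ln (real n)) \<le> ereal (ln (real (card (word_ball G S n))) / ln (real n))"
      by (simp add: ln_realpow divide_right_mono)
  qed
  also have "\<dots> \<le> GKdim_group_algebra F G"
    by (rule limsup_word_ball_le_GKdim[OF S])
  finally show ?thesis by simp
qed

lemma (in group) GKdim_ge_if_polynomial_growth:
  fixes d :: nat
  assumes S: "finite S" "S \<subseteq> carrier G" and c: "c > 0"
    and growth: "\<And>r. c * real r ^ d \<le> real (card (word_ball G S r))"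
  shows "ereal d \<le> GKdim_group_algebra (F :: 'f::field itself) G"
proof -
  have "(\<lambda>n. (ln c + d * ln (real n)) / ln (real n)) \<longlonglongrightarrow> d"
    by real_asymp
  then have "ereal d = limsup (\<lambda>n. ereal ((ln c + d * ln (real n)) / ln (real n)))"
    by (intro lim_imp_Limsup[symmetric]) auto
  also have "\<dots> \<le> limsup (\<lambda>n. ereal (ln (real (card (word_ball G S n))) / ln (real n)))"
  proof (intro Limsup_mono eventually_mono[OF eventually_gt_at_top[of 1]])
    fix n :: nat assume n: "n > 1"
    have "ln (c * real n ^ d) \<le> ln (real (card (word_ball G S n)))"
      using growth[of n] c n by (intro ln_mono) auto
    with n c show "ereal ((ln c + d * ln (real n)) / ln (real n)) \<le> ereal (ln (real (card (word_ball G S n))) / ln (real n))"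
      by (simp add: ln_mult ln_realpow divide_right_mono)
  qed
  also have "\<dots> \<le> GKdim_group_algebra F G"
    by (rule limsup_word_ball_le_GKdim[OF S])
  finally show ?thesis .
qed

section \<open>Exponential growth from a free pair\<close>

lemma free_reduced_iff_successively:
  "free_reduced w \<longleftrightarrow> successively (\<lambda>l l'. fst l = fst l' \<longrightarrow> snd l = snd l') w"
  unfolding free_reduced_def successively_conv_nth by blast

lemma successively_same_sign:
  "successively (\<lambda>l l'. fst l = fst l' \<longrightarrow> snd l = snd l') (map (\<lambda>b. (b, e)) bs)"
  by (induction bs rule: induct_list012) auto

text \<open>The positive words in a free pair are pairwise distinct.\<close>

lemma (in group) exponential_growth_if_free_subgroup:
  assumes free: "has_free_subgroup_rank2 G"
    and S: "finite S" "S \<subseteq> carrier G" "generate G S = carrier G"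
  shows "exponential_growth G"
proof -
  obtain x y where xy: "x \<in> carrier G" "y \<in> carrier G"
    and nontriv: "\<And>w. w \<noteq> [] \<Longrightarrow> free_reduced w \<Longrightarrow> foldr (\<otimes>) (map (eval_letter G x y) w) \<one> \<noteq> \<one>"
    using free unfolding has_free_subgroup_rank2_def by blast
  define ev where "ev w = foldr (\<otimes>) (map (eval_letter G x y) w) \<one>" for w
  define pos :: "bool list \<Rightarrow> (bool \<times> bool) list" where "pos = map (\<lambda>b. (b, False))"
  define neg :: "bool list \<Rightarrow> (bool \<times> bool) list" where "neg = map (\<lambda>b. (b, True))"
  have letter: "eval_letter G x y l \<in> carrier G" for l
    using xy by (simp add: eval_letter_def Let_def)
  have ev_closed: "ev w \<in> carrier G" for w
    unfolding ev_def using letter by (intro foldr_mult_closed) auto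
  have ev_append: "ev (v @ w) = ev v \<otimes> ev w" for v w
    unfolding ev_def map_append using letter by (intro foldr_mult_append) auto
  have ev_neg: "ev (neg (rev bs)) \<otimes> ev (pos bs) = \<one>" for bs
  proof (induction bs)
    case (Cons b bs)
    have "ev (neg (rev (b # bs))) \<otimes> ev (pos (b # bs))
        = ev (neg (rev bs)) \<otimes> (ev [(b, True)] \<otimes> ev [(b, False)]) \<otimes> ev (pos bs)"
      using ev_append[of "neg (rev bs)" "[(b, True)]"] ev_append[of "[(b, False)]" "pos bs"] ev_closed
      by (simp add: neg_def pos_def m_assoc)
    also have "ev [(b, True)] \<otimes> ev [(b, False)] = \<one>"
      using xy by (simp add: ev_def eval_letter_def Let_def)
    finally show ?case
      using Cons ev_closed by simp
  qed (simp add: ev_def neg_def pos_def)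
  have inj: "bs = cs" if "ev (pos bs) = ev (pos cs)" for bs cs
    using that
  proof (induction bs cs rule: list_induct2')
    case (2 b bs)
    have "free_reduced (pos (b # bs))"
      unfolding free_reduced_iff_successively pos_def by (rule successively_same_sign)
    with 2 nontriv[of "pos (b # bs)"] show ?case by (simp add: ev_def pos_def)
  next
    case (3 b bs)
    have "free_reduced (pos (b # bs))"
      unfolding free_reduced_iff_successively pos_def by (rule successively_same_sign)
    with 3 nontriv[of "pos (b # bs)"] show ?case by (simp add: ev_def pos_def)
  next
    case (4 b bs c cs)
    show ?case
    proof (cases "b = c")
      case True
      have "ev [(b, False)] \<otimes> ev (pos bs) = ev [(b, False)] \<otimes> ev (pos cs)"
        using 4(2) True ev_append[of "[(b, False)]" "pos bs"] ev_append[of "[(b, False)]" "pos cs"]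
        by (simp add: pos_def)
      then show ?thesis
        using 4(1) True ev_closed by simp
    next
      case False
      \<comment> \<open>The formal inverse of one word followed by the other. At the junction the
        inverse of \<open>b\<close> meets \<open>c\<close>, a different generator, so nothing
        cancels; yet equal values force \<open>w\<close> to evaluate to the identity.\<close>
      define w where "w = neg (rev (b # bs)) @ pos (c # cs)"
      have "free_reduced w"
        unfolding free_reduced_iff_successively w_def successively_append_iff
        using False successively_same_sign[where bs = "rev (b # bs)" and e = True]
          successively_same_sign[where bs = "c # cs" and e = False]
        by (auto simp: neg_def pos_def last_map hd_map simp del: list.map)
      moreover have "ev w = \<one>"
        unfolding w_def ev_append 4(2)[symmetric] by (rule ev_neg)
      ultimately show ?thesis
        using nontriv[of w] by (auto simp: ev_def w_def pos_def)
    qed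
  qed simp
  \<comment> \<open>Exponential growth asks for some generating set, so the free pair may be
    adjoined to \<open>S\<close>. The 2^r positive words of length r then lie in the ball of radius
    r.\<close>
  define T where "T = insert x (insert y S)"
  have T: "finite T" "T \<subseteq> carrier G"
    using S xy by (auto simp: T_def)
  have "generate G T = carrier G"
  proof
    show "carrier G \<subseteq> generate G T"
      using mono_generate[of S T] S(3) by (auto simp: T_def)
  qed (use generate_incl T in blast)
  moreover have "2 ^ r \<le> real (card (word_ball G T r))" for r
  proof -
    let ?L = "{bs. set bs \<subseteq> (UNIV :: bool set) \<and> length bs = r}"
    have "(\<lambda>bs. ev (pos bs)) ` ?L \<subseteq> word_ball G T r"
    proof clarify
      fix bs :: "bool list"
      have "set (map (eval_letter G x y) (pos bs)) \<subseteq> T \<union> (\<lambda>s. inv s) ` T"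
        by (auto simp: pos_def T_def eval_letter_def)
      then show "ev (pos bs) \<in> word_ball G T (length bs)"
        unfolding word_ball_def ev_def
        by (intro CollectI exI[of _ "map (eval_letter G x y) (pos bs)"]) (simp add: pos_def)
    qed
    then have "card ((\<lambda>bs. ev (pos bs)) ` ?L) \<le> card (word_ball G T r)"
      by (intro card_mono finite_word_ball T)
    moreover have "card ((\<lambda>bs. ev (pos bs)) ` ?L) = 2 ^ r"
      using inj card_lists_length_eq[of "UNIV :: bool set" r]
      by (subst card_image) (auto intro!: inj_onI)
    ultimately show ?thesis
      by (metis of_nat_le_iff of_nat_numeral of_nat_power)
  qed
  ultimately show ?thesis
    unfolding exponential_growth_def using T by (intro exI[of _ T]) (auto intro!: exI[of _ 2])
qed

subsection \<open>Rank one\<close>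

lemma Isub_1_commute:
  assumes "m \<in> Isub 1 n" "m' \<in> Isub 1 n"
  shows "manturov_eq 1 n [m, m'] [m', m]"
proof -
  obtain i j where ij: "m = {i}" "m' = {j}" "i \<in> {1..n}" "j \<in> {1..n}"
    using assms by (auto simp: Isub_def card_1_singleton_iff)
  show ?thesis
  proof (cases "i = j")
    case True
    then show ?thesis using assms ij by (auto intro: manturov_eq.refl)
  next
    case False
    \<comment> \<open>Removing the first entry of [j, i] leaves {i}, so relation (3) for these two
      points reads mm' = m'm.\<close>
    then have "manturov_rel 1 n (map (\<lambda>k. set [j, i] - {[j, i] ! k}) [0..<1 + 1])
        (rev (map (\<lambda>k. set [j, i] - {[j, i] ! k}) [0..<1 + 1]))"
      using ij by (intro manturov_rel.tetra) auto
    moreover have "{j, i} - {j} = {i}" "{j, i} - {i} = {j}"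
      using False by auto
    ultimately show ?thesis
      using ij by (auto intro: manturov_eq_rel)
  qed
qed

lemma Isub_1_move:
  assumes "m \<in> Isub 1 n" "set w \<subseteq> Isub 1 n"
  shows "manturov_eq 1 n (m # w) (w @ [m])"
  using assms
proof (induction w)
  case Nil
  then show ?case by (auto intro: manturov_eq.refl)
next
  case (Cons a w)
  then have "manturov_eq 1 n ([m, a] @ w) ([a, m] @ w)"
    using manturov_eq_append[OF Isub_1_commute, of m n a "[]" w] by simp
  moreover have "manturov_eq 1 n ([a] @ (m # w) @ []) ([a] @ (w @ [m]) @ [])"
    using Cons by (intro manturov_eq_append) auto
  ultimately show ?case
    by (auto intro: manturov_eq.trans)
qed

text \<open>One copy of a repeated generator is moved next to another and the pair cancels,
  shortening the word by two. Repetition-free words over a finite alphabet are finite in number,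
  whence the finiteness of the group.\<close>

lemma Isub_1_distinct:
  assumes "set w \<subseteq> Isub 1 n"
  obtains v where "distinct v" "set v \<subseteq> Isub 1 n" "manturov_eq 1 n w v"
  using assms
proof (induction w arbitrary: thesis rule: length_induct)
  case (1 w)
  show ?case
  proof (cases "distinct w")
    case True
    then show ?thesis
      using 1 by (auto intro: manturov_eq.refl)
  next
    case False
    then obtain xs ys zs m where w: "w = xs @ [m] @ ys @ [m] @ zs"
      using not_distinct_decomp by blast
    have sub: "set xs \<subseteq> Isub 1 n" "set ys \<subseteq> Isub 1 n" "set zs \<subseteq> Isub 1 n" "m \<in> Isub 1 n"
      using 1 w by auto
    have "manturov_eq 1 n (xs @ (m # ys) @ (m # zs)) (xs @ (ys @ [m]) @ (m # zs))"
      using sub by (intro manturov_eq_append Isub_1_move) auto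
    moreover have "manturov_eq 1 n ((xs @ ys) @ [m, m] @ zs) ((xs @ ys) @ [] @ zs)"
      using sub by (intro manturov_eq.step manturov_rel.inv) auto
    ultimately have eq: "manturov_eq 1 n w (xs @ ys @ zs)"
      unfolding w by (auto intro: manturov_eq.trans)
    have "length (xs @ ys @ zs) < length w" "set (xs @ ys @ zs) \<subseteq> Isub 1 n"
      using w sub by auto
    then obtain v where "distinct v" "set v \<subseteq> Isub 1 n" "manturov_eq 1 n (xs @ ys @ zs) v"
      using "1.IH" by blast
    then show ?thesis
      using 1 eq by (blast intro: manturov_eq.trans)
  qed
qed

lemma finite_Manturov_1: "finite (carrier (Manturov_group 1 n))"
proof (rule finite_subset)
  show "carrier (Manturov_group 1 n) \<subseteq> word_class 1 n ` {v. set v \<subseteq> Isub 1 n \<and> distinct v}"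
  proof
    fix g assume "g \<in> carrier (Manturov_group 1 n)"
    then obtain w where w: "set w \<subseteq> Isub 1 n" "g = word_class 1 n w"
      by (rule Manturov_carrierE)
    obtain v where v: "distinct v" "set v \<subseteq> Isub 1 n" "manturov_eq 1 n w v"
      using Isub_1_distinct w(1) .
    then have "g = word_class 1 n v"
      using w word_class_eq_iff by blast
    with v show "g \<in> word_class 1 n ` {v. set v \<subseteq> Isub 1 n \<and> distinct v}"
      by blast
  qed
  have "{v. set v \<subseteq> Isub 1 n \<and> distinct v} \<subseteq> {v. set v \<subseteq> Isub 1 n \<and> length v \<le> card (Isub 1 n)}"
    by (auto simp: finite_Isub card_mono simp flip: distinct_card)
  then have "finite {v. set v \<subseteq> Isub 1 n \<and> distinct v}"
    using finite_lists_length_le[OF finite_Isub] finite_subset by blast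
  then show "finite (word_class 1 n ` {v. set v \<subseteq> Isub 1 n \<and> distinct v})"
    by simp
qed

lemma has_growth_0_if_finite:
  assumes "group G" "finite (carrier G)"
  shows "has_growth (F :: 'f::field itself) G 0"
proof -
  interpret group G by fact
  have "GKdim_group_algebra F G \<le> ereal (0 :: nat)"
    using assms(2) by (intro GKdim_le_if_length_function[of "\<lambda>_. 0" "card (carrier G)"]) auto
  \<comment> \<open>Even the empty set has balls of size 1, which is enough in degree 0.\<close>
  moreover have "ereal (0 :: nat) \<le> GKdim_group_algebra F G"
  proof (rule GKdim_ge_if_polynomial_growth[of "{}" 1])
    fix r
    have "word_ball G {} r = {\<one>\<^bsub>G\<^esub>}"
      by (auto simp: word_ball_def)
    then show "1 * real r ^ 0 \<le> real (card (word_ball G {} r))"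
      by simp
  qed auto
  ultimately show ?thesis
    unfolding has_growth_def by simp
qed

subsection \<open>Rank two on three points\<close>

text \<open>The generators act on the lattice by the point reflections p \<mapsto> v - p.  The words ba and ca
  are then the unit translations.\<close>

definition refl_a :: "nat set" where "refl_a = {1, 3}"
definition refl_b :: "nat set" where "refl_b = {2, 3}"
definition refl_c :: "nat set" where "refl_c = {1, 2}"

definition reflect :: "nat set \<Rightarrow> int \<times> int \<Rightarrow> int \<times> int" where
  "reflect m p = (if m = refl_b then (1, 0) else if m = refl_c then (0, 1) else (0, 0)) - p"

lemma Isub_2_3: "Isub 2 3 = {refl_a, refl_b, refl_c}"
proof -
  have "{1..3} = {1, 2, 3 :: nat}" by auto
  then have "Isub 2 3 = {m \<in> Pow {1, 2, 3}. card m = 2}"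
    by (auto simp: Isub_def)
  also have "\<dots> = {refl_a, refl_b, refl_c}"
    by (auto simp: Pow_insert refl_a_def refl_b_def refl_c_def)
  finally show ?thesis .
qed

lemma refl_distinct: "refl_a \<noteq> refl_b" "refl_a \<noteq> refl_c" "refl_b \<noteq> refl_c"
  by (auto simp: refl_a_def refl_b_def refl_c_def)

text \<open>A composite of three point reflections, u - (v - (w - p)) = u - v + w - p, is unchanged
  when u and w are exchanged, which is relation (3). Any two of the three pairs meet, so relation
  (2) has no instances.\<close>

lemma reflect_manturov_eq:
  assumes "manturov_eq 2 3 v w"
  shows "foldr reflect v = foldr reflect w"
proof (rule foldr_eq_if_manturov_eq[OF _ assms])
  fix l r assume "manturov_rel 2 3 l r"
  then show "foldr reflect l = foldr reflect r"
  proof cases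
    case (comm m m')
    then show ?thesis
      by (auto simp: Isub_2_3 refl_a_def refl_b_def refl_c_def)
  next
    case (tetra u)
    then show ?thesis
      by (auto simp: fun_eq_iff reflect_def numeral_eq_Suc upt_rec)
  qed (auto simp: fun_eq_iff reflect_def)
qed

section \<open>The action of group elements on the lattice\<close>

abbreviation (input) G23 :: "nat set list set monoid" where
  "G23 \<equiv> Manturov_group 2 3"

interpretation G23: group G23
  by (rule group_Manturov)

definition act :: "nat set list set \<Rightarrow> int \<times> int \<Rightarrow> int \<times> int" where
  "act g = foldr reflect (SOME w. set w \<subseteq> Isub 2 3 \<and> g = word_class 2 3 w)"

lemma act_word_class:
  assumes "set w \<subseteq> Isub 2 3"
  shows "act (word_class 2 3 w) = foldr reflect w"
proof -
  define v where "v = (SOME v. set v \<subseteq> Isub 2 3 \<and> word_class 2 3 w = word_class 2 3 v)"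
  have "set v \<subseteq> Isub 2 3 \<and> word_class 2 3 w = word_class 2 3 v"
    unfolding v_def by (rule someI[of _ w]) (simp add: assms)
  then have "manturov_eq 2 3 w v"
    using word_class_eq_iff by blast
  from reflect_manturov_eq[OF this] show ?thesis
    unfolding act_def v_def by simp
qed

lemma act_mult: "g \<in> carrier G23 \<Longrightarrow> h \<in> carrier G23 \<Longrightarrow> act (g \<otimes>\<^bsub>G23\<^esub> h) p = act g (act h p)"
  by (auto elim!: Manturov_carrierE simp: act_word_class word_class_mult)

definition gen_a :: "nat set list set" where "gen_a = word_class 2 3 [refl_a]"
definition trans_x :: "nat set list set" where "trans_x = word_class 2 3 [refl_b, refl_a]"
definition trans_y :: "nat set list set" where "trans_y = word_class 2 3 [refl_c, refl_a]"

lemma carrier_G23 [simp]: "gen_a \<in> carrier G23" "trans_x \<in> carrier G23" "trans_y \<in> carrier G23"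
  by (simp_all add: gen_a_def trans_x_def trans_y_def word_class_in_carrier Isub_2_3)

lemma inv_G23:
  "inv\<^bsub>G23\<^esub> gen_a = gen_a" "inv\<^bsub>G23\<^esub> trans_x = word_class 2 3 [refl_a, refl_b]"
  "inv\<^bsub>G23\<^esub> trans_y = word_class 2 3 [refl_a, refl_c]"
  by (simp_all add: gen_a_def trans_x_def trans_y_def inv_word_class Isub_2_3)

lemma word_class_cancel:
  assumes "set v \<subseteq> Isub k n" "set w \<subseteq> Isub k n" "m \<in> Isub k n"
  shows "word_class k n (v @ m # m # w) = word_class k n (v @ w)"
proof -
  have "manturov_eq k n (v @ [m, m] @ w) (v @ [] @ w)"
    using assms by (intro manturov_eq.step manturov_rel.inv) auto
  then show ?thesis
    using assms by (simp add: word_class_eq_iff)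
qed

text \<open>Both sides are one word bracketed differently: aba in the first equation, aca in the
  second. So conjugation by \<open>gen_a\<close> inverts the two translations.\<close>

lemma gen_a_conj:
  "gen_a \<otimes>\<^bsub>G23\<^esub> trans_x = inv\<^bsub>G23\<^esub> trans_x \<otimes>\<^bsub>G23\<^esub> gen_a"
  "gen_a \<otimes>\<^bsub>G23\<^esub> trans_y = inv\<^bsub>G23\<^esub> trans_y \<otimes>\<^bsub>G23\<^esub> gen_a"
  unfolding inv_G23 unfolding gen_a_def trans_x_def trans_y_def
  by (simp_all add: word_class_mult Isub_2_3)

text \<open>Relation (3) for the sequence 1, 2, 3 says bac = cab; appending a gives (ba)(ca) =
  (ca)(ba).\<close>

lemma trans_commute: "trans_x \<otimes>\<^bsub>G23\<^esub> trans_y = trans_y \<otimes>\<^bsub>G23\<^esub> trans_x"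
proof -
  have "manturov_rel 2 3 (map (\<lambda>j. set [1, 2, 3] - {[1, 2, 3] ! j}) [0..<2 + 1])
      (rev (map (\<lambda>j. set [1, 2, 3] - {[1, 2, 3] ! j}) [0..<2 + 1]))"
    by (rule manturov_rel.tetra) auto
  moreover have "map (\<lambda>j. set [1, 2, 3] - {[1, 2, 3 :: nat] ! j}) [0..<2 + 1] = [refl_b, refl_a, refl_c]"
    by (auto simp: numeral_eq_Suc upt_rec refl_a_def refl_b_def refl_c_def)
  ultimately have "manturov_eq 2 3 ([] @ [refl_b, refl_a, refl_c] @ [refl_a]) ([] @ [refl_c, refl_a, refl_b] @ [refl_a])"
    by (intro manturov_eq.step) (simp_all add: Isub_2_3)
  then show ?thesis
    by (simp add: trans_x_def trans_y_def word_class_mult Isub_2_3 word_class_eq_iff)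
qed


text \<open>Used with y = x, where it makes powers commute, and with y the inverse of x, where it
  yields the sign change of exponents under \<open>gen_a\<close>.\<close>

lemma (in group) int_pow_intertwine:
  assumes "a \<in> carrier G" "x \<in> carrier G" "y \<in> carrier G" and eq: "a \<otimes> x = y \<otimes> a"
  shows "a \<otimes> x [^] (i :: int) = y [^] i \<otimes> a"
proof (induction i rule: int_induct[where k = 0])
  case base
  then show ?case using assms by simp
next
  case (step1 i)
  have "a \<otimes> x [^] (i + 1) = (a \<otimes> x [^] i) \<otimes> x"
    using assms by (simp add: int_pow_mult m_assoc)
  also have "\<dots> = y [^] i \<otimes> (a \<otimes> x)"
    unfolding step1.IH using assms by (simp add: m_assoc)
  also have "\<dots> = y [^] (i + 1) \<otimes> a"
    unfolding eq using assms by (simp add: int_pow_mult m_assoc)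
  finally show ?case .
next
  case (step2 i)
  \<comment> \<open>Negative exponents need the relation for the inverses: cancel x on the right and
    y on the left of ax = ya.\<close>
  have "(a \<otimes> x) \<otimes> inv x = y \<otimes> (a \<otimes> inv x)"
    unfolding eq using assms by (simp add: m_assoc)
  then have "a = y \<otimes> (a \<otimes> inv x)"
    using assms(1,2) by (simp add: m_assoc)
  then have eq': "a \<otimes> inv x = inv y \<otimes> a"
    by (intro inv_solve_left[THEN iffD2] m_closed inv_closed assms(1-3))
  have "a \<otimes> x [^] (i - 1) = (a \<otimes> x [^] i) \<otimes> inv x"
    using assms by (simp add: int_pow_diff m_assoc)
  also have "\<dots> = y [^] i \<otimes> (a \<otimes> inv x)"
    unfolding step2.IH using assms by (simp add: m_assoc)
  also have "\<dots> = y [^] (i - 1) \<otimes> a"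
    unfolding eq' using assms by (simp add: int_pow_diff m_assoc)
  finally show ?case .
qed

section \<open>Translations and the normal form\<close>

definition translation :: "int \<Rightarrow> int \<Rightarrow> nat set list set" where
  "translation i j = trans_x [^]\<^bsub>G23\<^esub> i \<otimes>\<^bsub>G23\<^esub> trans_y [^]\<^bsub>G23\<^esub> j"

lemma translation_carrier [simp]: "translation i j \<in> carrier G23"
  by (simp add: translation_def)

lemma trans_pow_commute:
  "trans_y [^]\<^bsub>G23\<^esub> (j :: int) \<otimes>\<^bsub>G23\<^esub> trans_x [^]\<^bsub>G23\<^esub> (i :: int) = trans_x [^]\<^bsub>G23\<^esub> i \<otimes>\<^bsub>G23\<^esub> trans_y [^]\<^bsub>G23\<^esub> j"
proof (rule G23.int_pow_intertwine)
  show "trans_y [^]\<^bsub>G23\<^esub> j \<otimes>\<^bsub>G23\<^esub> trans_x = trans_x \<otimes>\<^bsub>G23\<^esub> trans_y [^]\<^bsub>G23\<^esub> j"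
    using G23.int_pow_intertwine[of trans_x trans_y trans_y j] by (simp add: trans_commute)
qed auto

lemma translation_mult:
  "translation i j \<otimes>\<^bsub>G23\<^esub> translation i' j' = translation (i + i') (j + j')"
proof -
  have "translation i j \<otimes>\<^bsub>G23\<^esub> translation i' j' = trans_x [^]\<^bsub>G23\<^esub> i \<otimes>\<^bsub>G23\<^esub>
      (trans_y [^]\<^bsub>G23\<^esub> j \<otimes>\<^bsub>G23\<^esub> trans_x [^]\<^bsub>G23\<^esub> i') \<otimes>\<^bsub>G23\<^esub> trans_y [^]\<^bsub>G23\<^esub> j'"
    by (simp add: translation_def G23.m_assoc)
  also have "\<dots> = translation (i + i') (j + j')"
    unfolding trans_pow_commute by (simp add: translation_def G23.int_pow_mult G23.m_assoc)
  finally show ?thesis .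
qed

lemma act_trans_pow:
  "act (trans_x [^]\<^bsub>G23\<^esub> (i :: int)) p = (i, 0) + p"
  "act (trans_y [^]\<^bsub>G23\<^esub> (i :: int)) p = (0, i) + p"
proof -
  have x: "act trans_x p = (1, 0) + p" "act (inv\<^bsub>G23\<^esub> trans_x) p = p - (1, 0)"
    and y: "act trans_y p = (0, 1) + p" "act (inv\<^bsub>G23\<^esub> trans_y) p = p - (0, 1)"
    and one: "act \<one>\<^bsub>G23\<^esub> p = p" for p
    unfolding inv_G23 using refl_distinct
    by (simp_all add: trans_x_def trans_y_def one_Manturov act_word_class Isub_2_3 reflect_def prod_eq_iff)
  show "act (trans_x [^]\<^bsub>G23\<^esub> i) p = (i, 0) + p"
    by (induction i arbitrary: p rule: int_induct[where k = 0])
      (simp_all add: one x G23.int_pow_mult G23.int_pow_diff act_mult prod_eq_iff zero_prod_def)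
  show "act (trans_y [^]\<^bsub>G23\<^esub> i) p = (0, i) + p"
    by (induction i arbitrary: p rule: int_induct[where k = 0])
      (simp_all add: one y G23.int_pow_mult G23.int_pow_diff act_mult prod_eq_iff zero_prod_def)
qed

lemma act_translation: "act (translation i j) p = (i, j) + p"
  by (simp add: translation_def act_mult act_trans_pow prod_eq_iff)

lemma act_gen_a: "act gen_a p = - p"
  using refl_distinct
  by (simp add: gen_a_def act_word_class Isub_2_3 reflect_def prod_eq_iff)

lemma gen_a_square: "gen_a \<otimes>\<^bsub>G23\<^esub> gen_a = \<one>\<^bsub>G23\<^esub>"
  using G23.r_inv[of gen_a] by (simp add: inv_G23)

lemma gen_a_translation:
  "gen_a \<otimes>\<^bsub>G23\<^esub> translation i j = translation (- i) (- j) \<otimes>\<^bsub>G23\<^esub> gen_a"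
proof -
  have x: "gen_a \<otimes>\<^bsub>G23\<^esub> trans_x [^]\<^bsub>G23\<^esub> i = trans_x [^]\<^bsub>G23\<^esub> (- i) \<otimes>\<^bsub>G23\<^esub> gen_a"
    and y: "gen_a \<otimes>\<^bsub>G23\<^esub> trans_y [^]\<^bsub>G23\<^esub> j = trans_y [^]\<^bsub>G23\<^esub> (- j) \<otimes>\<^bsub>G23\<^esub> gen_a"
    using G23.int_pow_intertwine[OF _ _ _ gen_a_conj(1), of i] G23.int_pow_intertwine[OF _ _ _ gen_a_conj(2), of j]
    by (simp_all add: G23.int_pow_inv G23.int_pow_neg)
  have "gen_a \<otimes>\<^bsub>G23\<^esub> translation i j = (gen_a \<otimes>\<^bsub>G23\<^esub> trans_x [^]\<^bsub>G23\<^esub> i) \<otimes>\<^bsub>G23\<^esub> trans_y [^]\<^bsub>G23\<^esub> j"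
    by (simp add: translation_def G23.m_assoc)
  also have "\<dots> = trans_x [^]\<^bsub>G23\<^esub> (- i) \<otimes>\<^bsub>G23\<^esub> (gen_a \<otimes>\<^bsub>G23\<^esub> trans_y [^]\<^bsub>G23\<^esub> j)"
    unfolding x by (simp add: G23.m_assoc)
  also have "\<dots> = translation (- i) (- j) \<otimes>\<^bsub>G23\<^esub> gen_a"
    unfolding y by (simp add: translation_def G23.m_assoc)
  finally show ?thesis .
qed

text \<open>Insert aa = 1: b = (ba)a and c = (ca)a.\<close>

lemma gen_eq_translation:
  "word_class 2 3 [refl_a] = gen_a"
  "word_class 2 3 [refl_b] = translation 1 0 \<otimes>\<^bsub>G23\<^esub> gen_a"
  "word_class 2 3 [refl_c] = translation 0 1 \<otimes>\<^bsub>G23\<^esub> gen_a"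
  using word_class_cancel[of "[refl_b]" 2 3 "[]" refl_a] word_class_cancel[of "[refl_c]" 2 3 "[]" refl_a]
  by (simp_all add: translation_def gen_a_def trans_x_def trans_y_def word_class_mult Isub_2_3
      word_class_in_carrier)

definition normal_form :: "int \<Rightarrow> int \<Rightarrow> bool \<Rightarrow> nat set list set" where
  "normal_form i j e = (if e then translation i j \<otimes>\<^bsub>G23\<^esub> gen_a else translation i j)"

lemma normal_form_carrier [simp]: "normal_form i j e \<in> carrier G23"
  by (simp add: normal_form_def)

lemma translation_normal_form:
  "translation i j \<otimes>\<^bsub>G23\<^esub> normal_form i' j' e = normal_form (i + i') (j + j') e"
  by (simp add: normal_form_def translation_mult flip: G23.m_assoc)

lemma gen_a_normal_form: "gen_a \<otimes>\<^bsub>G23\<^esub> normal_form i j e = normal_form (- i) (- j) (\<not> e)"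
proof -
  have "gen_a \<otimes>\<^bsub>G23\<^esub> (translation i j \<otimes>\<^bsub>G23\<^esub> gen_a) = (gen_a \<otimes>\<^bsub>G23\<^esub> translation i j) \<otimes>\<^bsub>G23\<^esub> gen_a"
    by (simp add: G23.m_assoc)
  also have "\<dots> = translation (- i) (- j)"
    unfolding gen_a_translation by (simp add: G23.m_assoc gen_a_square)
  finally show ?thesis
    by (simp add: normal_form_def gen_a_translation)
qed

text \<open>A letter put in front of a normal form first lets \<open>gen_a\<close> pass, which
  negates the exponents and switches the flag, and then adds its translation to the
  exponents.\<close>

lemma G23_normal_form:
  assumes "g \<in> carrier G23"
  obtains i j e where "g = normal_form i j e"
proof -
  have "\<exists>i j e. word_class 2 3 w = normal_form i j e" if "set w \<subseteq> Isub 2 3" for w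
    using that
  proof (induction w)
    case Nil
    have "word_class 2 3 [] = normal_form 0 0 False"
      by (simp add: normal_form_def translation_def flip: one_Manturov)
    then show ?case by blast
  next
    case (Cons m w)
    then obtain i j e where w: "word_class 2 3 w = normal_form i j e" by auto
    have "word_class 2 3 (m # w) = word_class 2 3 [m] \<otimes>\<^bsub>G23\<^esub> normal_form i j e"
      using Cons.prems by (simp add: word_class_mult flip: w)
    moreover have "m = refl_a \<or> m = refl_b \<or> m = refl_c"
      using Cons.prems by (simp add: Isub_2_3)
    ultimately show ?case
      by (elim disjE; simp add: gen_eq_translation G23.m_assoc gen_a_normal_form translation_normal_form; blast)
  qed
  with assms that show thesis
    by (metis Manturov_carrierE)
qed

lemma act_normal_form: "act (normal_form i j e) p = (i, j) + (if e then - p else p)"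
  by (simp add: normal_form_def act_mult act_translation act_gen_a)

lemma inj_translation: "inj (\<lambda>(i, j). translation i j)"
proof (rule injI, clarify)
  fix i j i' j' assume "translation i j = translation i' j'"
  then have "act (translation i j) (0, 0) = act (translation i' j') (0, 0)" by simp
  then show "i = i' \<and> j = j'" by (simp add: act_translation)
qed

text \<open>The l1 norm of the image of the origin. It vanishes on \<open>gen_a\<close> too, which
  is harmless: a length function only has to be subadditive with small balls.\<close>

definition displacement :: "nat set list set \<Rightarrow> nat" where
  "displacement g = nat (\<bar>fst (act g (0, 0))\<bar> + \<bar>snd (act g (0, 0))\<bar>)"

lemma displacement_normal_form: "displacement (normal_form i j e) = nat (\<bar>i\<bar> + \<bar>j\<bar>)"
  by (simp add: displacement_def act_normal_form)

text \<open>The product sends the origin to (i, j) + (i', j') or (i, j) - (i', j'), depending on the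
  reflection part of \<open>g\<close>; the triangle inequality works coordinatewise in both
  cases.\<close>

lemma displacement_mult:
  assumes "g \<in> carrier G23" "h \<in> carrier G23"
  shows "displacement (g \<otimes>\<^bsub>G23\<^esub> h) \<le> displacement g + displacement h"
proof -
  obtain i j e i' j' e' where gh: "g = normal_form i j e" "h = normal_form i' j' e'"
    using assms G23_normal_form by metis
  have "\<bar>fst (act (g \<otimes>\<^bsub>G23\<^esub> h) (0, 0))\<bar> + \<bar>snd (act (g \<otimes>\<^bsub>G23\<^esub> h) (0, 0))\<bar>
      \<le> (\<bar>i\<bar> + \<bar>i'\<bar>) + (\<bar>j\<bar> + \<bar>j'\<bar>)"
    unfolding gh
    by (rule add_mono) (simp_all add: act_mult act_normal_form abs_triangle_ineq abs_triangle_ineq4)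
  then have "displacement (g \<otimes>\<^bsub>G23\<^esub> h) \<le> nat ((\<bar>i\<bar> + \<bar>j\<bar>) + (\<bar>i'\<bar> + \<bar>j'\<bar>))"
    unfolding displacement_def by (intro nat_mono) simp
  also have "\<dots> = displacement g + displacement h"
    unfolding gh displacement_normal_form by (rule nat_add_distrib) auto
  finally show ?thesis .
qed

lemma displacement_ball:
  "{g \<in> carrier G23. displacement g \<le> r} \<subseteq>
    (\<lambda>(i, j, e). normal_form i j e) ` ({- int r..int r} \<times> {- int r..int r} \<times> UNIV)"
proof clarify
  fix g assume "g \<in> carrier G23" "displacement g \<le> r"
  then obtain i j e where g: "g = normal_form i j e"
    using G23_normal_form by metis
  with \<open>displacement g \<le> r\<close> have "\<bar>i\<bar> \<le> int r" "\<bar>j\<bar> \<le> int r"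
    by (simp_all add: displacement_normal_form)
  with g show "g \<in> (\<lambda>(i, j, e). normal_form i j e) ` ({- int r..int r} \<times> {- int r..int r} \<times> UNIV)"
    by (intro image_eqI[of _ _ "(i, j, e)"]) auto
qed

lemma G23_growth: "has_growth (F :: 'f::field itself) G23 2"
proof -
  have "GKdim_group_algebra F G23 \<le> ereal (2 :: nat)"
  \<comment> \<open>A ball of radius r has at most 2(2r + 1)^2 elements, and 2r + 1 \<le> 2(r + 1)
    gives the factor 8.\<close>
  proof (rule G23.GKdim_le_if_length_function[of displacement 8])
    show "displacement \<one>\<^bsub>G23\<^esub> = 0"
      by (simp add: displacement_def one_Manturov act_word_class)
  next
    fix r
    let ?T = "{- int r..int r} \<times> {- int r..int r} \<times> (UNIV :: bool set)"
    show "finite {g \<in> carrier G23. displacement g \<le> r}"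
      by (rule finite_subset[OF displacement_ball]) auto
    have "card {g \<in> carrier G23. displacement g \<le> r} \<le> card ((\<lambda>(i, j, e). normal_form i j e) ` ?T)"
      by (rule card_mono[OF _ displacement_ball]) auto
    also have "\<dots> \<le> card ?T"
      by (rule card_image_le) auto
    also have "\<dots> = (2 * r + 1) * ((2 * r + 1) * 2)"
    proof -
      have "card {- int r..int r} = 2 * r + 1"
        by (simp add: nat_eq_iff)
      then show ?thesis
        by (simp only: card_cartesian_product card_UNIV_bool)
    qed
    also have "\<dots> \<le> 8 * (r + 1) ^ 2"
      by (simp add: power2_eq_square algebra_simps)
    finally show "card {g \<in> carrier G23. displacement g \<le> r} \<le> 8 * (r + 1) ^ 2" .
  qed (rule displacement_mult)
  moreover have "ereal (2 :: nat) \<le> GKdim_group_algebra F G23"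
  \<comment> \<open>Exponents up to r div 2 in both directions use at most r letters and give (r div
    2 + 1)^2 distinct translations; r div 2 + 1 \<ge> r/2 gives the factor 1/4.\<close>
  proof (rule G23.GKdim_ge_if_polynomial_growth[of "{trans_x, trans_y}" "1 / 4"])
    fix r :: nat
    let ?T = "{0..int (r div 2)} \<times> {0..int (r div 2)}"
    have rep: "((\<otimes>\<^bsub>G23\<^esub>) x ^^ n) \<one>\<^bsub>G23\<^esub> = x [^]\<^bsub>G23\<^esub> n"
      if "x \<in> carrier G23" for x and n :: nat
      using that by (induction n) (simp_all flip: G23.nat_pow_Suc2)
    have "(\<lambda>(i, j). translation i j) ` ?T \<subseteq> word_ball G23 {trans_x, trans_y} r"
    proof clarify
      fix i j assume "i \<in> {0..int (r div 2)}" "j \<in> {0..int (r div 2)}"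
      then have ij: "nat i + nat j \<le> r" "int (nat i) = i" "int (nat j) = j"
        by auto
      let ?ws = "replicate (nat i) trans_x @ replicate (nat j) trans_y"
      have "translation i j = trans_x [^]\<^bsub>G23\<^esub> nat i \<otimes>\<^bsub>G23\<^esub> trans_y [^]\<^bsub>G23\<^esub> nat j"
        unfolding translation_def int_pow_int[symmetric] ij(2,3) ..
      also have "\<dots> = foldr (\<otimes>\<^bsub>G23\<^esub>) ?ws \<one>\<^bsub>G23\<^esub>"
        by (subst G23.foldr_mult_append) (auto simp: rep)
      finally show "translation i j \<in> word_ball G23 {trans_x, trans_y} r"
        unfolding word_ball_def using ij(1) by (intro CollectI exI[of _ ?ws]) auto
    qed
    then have "card ((\<lambda>(i, j). translation i j) ` ?T) \<le> card (word_ball G23 {trans_x, trans_y} r)"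
      by (intro card_mono finite_word_ball) auto
    moreover have "card ((\<lambda>(i, j). translation i j) ` ?T) = (r div 2 + 1) ^ 2"
      by (subst card_image[OF inj_on_subset[OF inj_translation]])
        (auto simp: card_cartesian_product power2_eq_square nat_add_distrib)
    ultimately have *: "(r div 2 + 1) ^ 2 \<le> card (word_ball G23 {trans_x, trans_y} r)"
      by simp
    have "1 / 4 * real r ^ 2 = (real r / 2) ^ 2"
      by (simp add: power_divide)
    also have "\<dots> \<le> real (r div 2 + 1) ^ 2"
      by (intro power_mono) linarith+
    also have "\<dots> = real ((r div 2 + 1) ^ 2)"
      by simp
    also have "\<dots> \<le> real (card (word_ball G23 {trans_x, trans_y} r))"
      using * by (simp only: of_nat_le_iff)
    finally show "1 / 4 * real r ^ 2 \<le> real (card (word_ball G23 {trans_x, trans_y} r))" .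
  qed auto
  ultimately show ?thesis
    unfolding has_growth_def by (simp add: antisym)
qed

lemma G23_virtually_Z2: "virtually_Z2 G23"
proof -
  let ?Z2 = "DirProd integer_group integer_group"
  let ?h = "\<lambda>(i, j). translation i j"
  define H where "H = range ?h"
  have carrier_Z2: "carrier ?Z2 = UNIV"
    by (simp add: DirProd_def)
  have "?h \<in> hom ?Z2 G23"
    by (auto simp: hom_def translation_mult)
  then interpret h: group_hom ?Z2 G23 ?h
    by (intro group_hom.intro group_hom_axioms.intro DirProd_group group_Manturov) auto
  have H: "subgroup H G23"
    using h.img_is_subgroup by (simp add: H_def carrier_Z2)
  have "?h \<in> iso ?Z2 (G23\<lparr>carrier := H\<rparr>)"
    using inj_translation
    by (auto simp: iso_def hom_def H_def carrier_Z2 bij_betw_def translation_mult)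
  then have "G23\<lparr>carrier := H\<rparr> \<cong> ?Z2"
    using h.G.iso_sym is_isoI by blast
  \<comment> \<open>The translation part of a normal form is absorbed by \<open>H\<close>, so only
    the flag can separate cosets.\<close>
  moreover have "rcosets\<^bsub>G23\<^esub> H \<subseteq> {H #>\<^bsub>G23\<^esub> \<one>\<^bsub>G23\<^esub>, H #>\<^bsub>G23\<^esub> gen_a}"
  proof
    fix K assume "K \<in> rcosets\<^bsub>G23\<^esub> H"
    then obtain g where g: "g \<in> carrier G23" "K = H #>\<^bsub>G23\<^esub> g"
      by (auto simp: RCOSETS_def)
    then obtain i j e where nf: "g = normal_form i j e"
      using G23_normal_form by metis
    define a where "a = (if e then gen_a else \<one>\<^bsub>G23\<^esub>)"
    have a: "a \<in> carrier G23" "g = translation i j \<otimes>\<^bsub>G23\<^esub> a"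
      by (simp_all add: nf normal_form_def a_def)
    have "translation i j \<in> H"
      by (force simp: H_def)
    then have "H #>\<^bsub>G23\<^esub> translation i j = H"
      using H by (intro G23.coset_join2) auto
    then have "K = H #>\<^bsub>G23\<^esub> a"
      using g a G23.coset_mult_assoc[of H "translation i j" a] subgroup.subset[OF H] by simp
    then show "K \<in> {H #>\<^bsub>G23\<^esub> \<one>\<^bsub>G23\<^esub>, H #>\<^bsub>G23\<^esub> gen_a}"
      by (auto simp: a_def)
  qed
  then have "finite (rcosets\<^bsub>G23\<^esub> H)"
    by (rule finite_subset) simp
  ultimately show ?thesis
    unfolding virtually_Z2_def using H by blast
qed

subsection \<open>Rank at least three\<close>

text \<open>The free product of the Klein four-group (acting by flips) and a group of order two (acting
  by toggling a head letter) acts on lists over the four-group.  Toggling fixes lists that start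
  with a repeated letter, which makes it an involution on all lists.\<close>

definition flip :: "bool \<times> bool \<Rightarrow> (bool \<times> bool) list \<Rightarrow> (bool \<times> bool) list" where
  "flip v = map (\<lambda>x. (fst x \<noteq> fst v, snd x \<noteq> snd v))"

definition toggle :: "'a \<Rightarrow> 'a list \<Rightarrow> 'a list" where
  "toggle l s = (case s of [] \<Rightarrow> [l]
     | x # t \<Rightarrow> if x \<noteq> l then l # s else if t \<noteq> [] \<and> hd t = l then s else t)"

lemma toggle_simps [simp]:
  "toggle l [] = [l]"
  "x \<noteq> l \<Longrightarrow> toggle l (x # t) = l # x # t"
  "x \<noteq> l \<Longrightarrow> toggle l (l # x # t) = x # t"
  by (simp_all add: toggle_def)

lemma toggle_toggle: "toggle l (toggle l s) = s"
  by (cases s; cases "tl s") (auto simp: toggle_def)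

lemma flip_flip: "flip u (flip v s) = flip (fst u \<noteq> fst v, snd u \<noteq> snd v) s"
  by (auto simp: flip_def)

lemma flip_id [simp]: "flip (False, False) s = s"
  by (simp add: flip_def)

lemma toggle_map: "inj f \<Longrightarrow> toggle (f l) (map f s) = map f (toggle l s)"
  by (cases s; cases "tl s") (auto simp: toggle_def inj_eq)

text \<open>A flip is an injective relabelling of order at most two that takes (False, False) to
  \<open>v\<close>. Thus every toggle is a conjugate of the single one assigned to the index
  4.\<close>

lemma flip_toggle_flip: "flip v (toggle (False, False) (flip v s)) = toggle v s"
proof -
  have "inj (\<lambda>x :: bool \<times> bool. (fst x \<noteq> fst v, snd x \<noteq> snd v))"
    by (auto simp: inj_def prod_eq_iff)
  from toggle_map[OF this, of "(False, False)" "flip v s"] show ?thesis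
    unfolding flip_def[symmetric] by (simp add: flip_flip)
qed

section \<open>The relations under the action on lists\<close>

definition index_action :: "nat \<Rightarrow> (bool \<times> bool) list \<Rightarrow> (bool \<times> bool) list" where
  "index_action i = (if i = 1 then flip (True, False) else if i = 2 then flip (False, True)
     else if i = 3 then flip (True, True) else if i = 4 then toggle (False, False) else id)"

lemma index_action_involution: "index_action i (index_action i s) = s"
  by (simp add: index_action_def flip_flip toggle_toggle)

lemma index_action_eq_flip: "i \<noteq> 4 \<Longrightarrow> index_action i s = flip (i = 1 \<or> i = 3, i = 2 \<or> i = 3) s"
  by (auto simp: index_action_def)

text \<open>Flips add in the Klein group: indices 1 and 3 move the first coordinate, 2 and 3 the
  second. Distinctness turns the parity of occurrences into membership.\<close>

lemma foldr_index_action_flip: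
  assumes "distinct p" "4 \<notin> set p"
  shows "foldr index_action p s =
    flip ((1 \<in> set p) \<noteq> (3 \<in> set p), (2 \<in> set p) \<noteq> (3 \<in> set p)) s"
  using assms
proof (induction p)
  case (Cons i p)
  then show ?case
    by (auto simp: index_action_eq_flip flip_flip intro!: arg_cong2[where f = flip])
qed simp

text \<open>The two segments around the index 4 contain each of 1, 2, 3 exactly once together, hence
  they act by the same flip and may be exchanged.\<close>

lemma foldr_index_action_rev:
  assumes "distinct u" "{1, 2, 3, 4} \<subseteq> set u"
  shows "foldr index_action (rev u) = foldr index_action u"
proof -
  obtain p q where u: "u = p @ 4 # q"
    using assms split_list[of 4 u] by auto
  have p: "distinct p" "4 \<notin> set p" and q: "distinct q" "4 \<notin> set q"
    using assms u by auto
  have split: "1 \<in> set p \<longleftrightarrow> 1 \<notin> set q" "2 \<in> set p \<longleftrightarrow> 2 \<notin> set q" "3 \<in> set p \<longleftrightarrow> 3 \<notin> set q"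
    using assms unfolding u by auto
  have flips: "(1 \<in> set p) \<noteq> (3 \<in> set p) \<longleftrightarrow> (1 \<in> set q) \<noteq> (3 \<in> set q)"
    "(2 \<in> set p) \<noteq> (3 \<in> set p) \<longleftrightarrow> (2 \<in> set q) \<noteq> (3 \<in> set q)"
    using split by blast+
  \<comment> \<open>Reversing \<open>u\<close> also reverses each segment, which is harmless: away
    from the index 4 the composite depends only on the set of indices.\<close>
  have rev: "foldr index_action (rev v) s = foldr index_action v s" if "distinct v" "4 \<notin> set v" for v s
    using foldr_index_action_flip[of "rev v"] foldr_index_action_flip[of v] that by simp
  have "foldr index_action p s = foldr index_action q s" for s
    unfolding foldr_index_action_flip[OF p] foldr_index_action_flip[OF q] flips by simp
  then have "foldr index_action (rev q) s = foldr index_action p s"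
    and "foldr index_action (rev p) s = foldr index_action q s" for s
    using rev p q by simp_all
  then show ?thesis
    unfolding u by (auto simp: fun_eq_iff)
qed

text \<open>A k-subset of {1..k+1} is identified with the point it misses; generators that use a
  larger point act trivially, so one action serves every n > k.\<close>

definition tree_action :: "nat \<Rightarrow> nat set \<Rightarrow> (bool \<times> bool) list \<Rightarrow> (bool \<times> bool) list" where
  "tree_action k m = (if m \<subseteq> {1..k + 1} then index_action (the_elem ({1..k + 1} - m)) else id)"

lemma tree_action_diff: "i \<in> {1..k + 1} \<Longrightarrow> tree_action k ({1..k + 1} - {i}) = index_action i"
proof -
  assume "i \<in> {1..k + 1}"
  then have "{1..k + 1} - ({1..k + 1} - {i}) = {i}" by blast
  then show ?thesis
    unfolding tree_action_def by auto
qed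

text \<open>Relation (3) on {1..k+1} is the reversal statement for \<open>index_action\<close>. In
  every instance of (2), and of (3) on another set of points, no two distinct letters both act
  nontrivially, so the maps commute.\<close>

lemma tree_action_rel:
  assumes k: "3 \<le> k" and "manturov_rel k n l r"
  shows "foldr (tree_action k) l = foldr (tree_action k) r"
  using assms(2)
proof cases
  case (inv m)
  then show ?thesis
    by (auto simp: fun_eq_iff tree_action_def index_action_involution)
next
  case (comm m m')
  \<comment> \<open>Two k-subsets of k + 1 points share at least k - 1 points, against the premise
    of (2).\<close>
  have "\<not> (m \<subseteq> {1..k + 1} \<and> m' \<subseteq> {1..k + 1})"
  proof
    assume *: "m \<subseteq> {1..k + 1} \<and> m' \<subseteq> {1..k + 1}"
    then have "card (m \<union> m') \<le> card {1..k + 1}"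
      by (intro card_mono) auto
    moreover have "finite m" "finite m'"
      using * finite_subset by auto
    then have "card m + card m' = card (m \<union> m') + card (m \<inter> m')"
      by (rule card_Un_Int)
    moreover have "card m = k" "card m' = k" "card {1..k + 1} = k + 1"
      using comm by (simp_all add: Isub_def)
    ultimately show False
      using comm(5) by linarith
  qed
  then have "tree_action k m = id \<or> tree_action k m' = id"
    by (auto simp: tree_action_def)
  then show ?thesis
    using comm by (auto simp: fun_eq_iff)
next
  case (tetra u)
  have l: "l = map (\<lambda>i. set u - {i}) u" and r: "r = rev l"
    using tetra(1,2) map_diff_nth[OF tetra(3), of "\<lambda>i. set u - {i}"] by (simp_all only:)
  have card: "card (set u) = k + 1"
    using tetra distinct_card by metis
  show ?thesis
  proof (cases "set u = {1..k + 1}")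
    case True
    have eq: "foldr (tree_action k) (map (\<lambda>i. set u - {i}) v) = foldr index_action v"
      if "set v \<subseteq> {1..k + 1}" for v
      using that unfolding True by (induction v) (use tree_action_diff[of _ k] in simp_all)
    \<comment> \<open>Here k \<ge> 3 enters: it puts the indices 1 to 4 into {1..k+1}.\<close>
    have "foldr index_action (rev u) = foldr index_action u"
      using True k tetra by (intro foldr_index_action_rev) auto
    then show ?thesis
      unfolding r l rev_map using True by (subst (1 2) eq) auto
  next
    case False
    \<comment> \<open>Two different letters have union \<open>set u\<close>. If both acted
      nontrivially, they would lie in {1..k+1}, and cardinalities would force \<open>set u\<close>
      to be that interval.\<close>
    have "x = y \<or> tree_action k x = id \<or> tree_action k y = id" if xy: "x \<in> set l" "y \<in> set l" for x y
    proof (rule ccontr)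
      assume *: "\<not> (x = y \<or> tree_action k x = id \<or> tree_action k y = id)"
      then have "x \<union> y \<subseteq> {1..k + 1}"
        by (auto simp: tree_action_def split: if_splits)
      moreover have "x \<union> y = set u"
        using xy * unfolding l by auto
      ultimately have "set u \<subseteq> {1..k + 1}" by simp
      then have "set u = {1..k + 1}"
        using card by (intro card_subset_eq) auto
      with False show False by simp
    qed
    then show ?thesis
      unfolding r by (intro foldr_rev_if_commute[symmetric]) (metis comp_id id_comp)
  qed
qed

text \<open>The maps by which the free pair and its inverses act, written in toggles alone so that
  the flips disappear from the computation.\<close>

definition free_letter :: "bool \<times> bool \<Rightarrow> (bool \<times> bool) list \<Rightarrow> (bool \<times> bool) list" where
  "free_letter l s = (if snd l then toggle (False, False) (toggle (\<not> fst l, fst l) s)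
     else toggle (\<not> fst l, fst l) (toggle (False, False) s))"

text \<open>The invariant records just enough of the head of the list. The new letter
  \<open>l\<close>, which acts last, can at most erase a leading (False, False). Beneath it lies the
  marker of the next letter, which differs from that of \<open>l\<close> unless both are the same
  generator; in that case the signs agree and nothing is erased.\<close>

lemma foldr_free_letter:
  assumes "successively (\<lambda>l l'. fst l = fst l' \<longrightarrow> snd l = snd l') (l # w)"
  shows "\<exists>t. foldr free_letter (l # w) [] =
    (if snd l then [(False, False)] else []) @ (\<not> fst l, fst l) # t"
  using assms
proof (induction w arbitrary: l)
  case Nil
  then show ?case by (simp add: free_letter_def)
next
  case (Cons l' w)
  then have "successively (\<lambda>l l'. fst l = fst l' \<longrightarrow> snd l = snd l') (l' # w)"
    by simp
  then obtain t where t: "foldr free_letter (l' # w) [] =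
      (if snd l' then [(False, False)] else []) @ (\<not> fst l', fst l') # t"
    using Cons.IH by blast
  have eq: "foldr free_letter (l # l' # w) [] =
      free_letter l ((if snd l' then [(False, False)] else []) @ (\<not> fst l', fst l') # t)"
    unfolding t[symmetric] by simp
  show ?case
    unfolding eq using Cons.prems
    by (cases "fst l"; cases "snd l"; cases "fst l'"; cases "snd l'") (simp_all add: free_letter_def)
qed

lemma Manturov_free_subgroup:
  assumes k: "3 \<le> k" "k < n"
  shows "has_free_subgroup_rank2 (Manturov_group k n)"
proof -
  let ?G = "Manturov_group k n"
  define gen where "gen i = {1..k + 1} - {i}" for i :: nat
  have gen: "gen i \<in> Isub k n" if "i \<in> {1..4}" for i
    using that k by (auto simp: gen_def Isub_def)
  have act_gen: "tree_action k (gen i) = index_action i" if "i \<in> {1..4}" for i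
    using that k tree_action_diff[of i k] by (simp add: gen_def)
  \<comment> \<open>The commutator of the involutions m and \<open>gen 4\<close>, or its reversal
    for the inverse. The block m, \<open>gen 4\<close>, m acts as a toggle at a letter other than
    (False, False).\<close>
  define word where "word l = (let m = gen (if fst l then 2 else 1) in
    if snd l then [gen 4, m, gen 4, m] else [m, gen 4, m, gen 4])" for l :: "bool \<times> bool"
  have word: "set (word l) \<subseteq> Isub k n" for l
    using gen by (auto simp: word_def Let_def)
  define x where "x = word_class k n (word (False, False))"
  define y where "y = word_class k n (word (True, False))"
  have letter: "eval_letter ?G x y l = word_class k n (word l)" for l
    using word[of "(False, False)"] word[of "(True, False)"]
    by (cases l) (auto simp: eval_letter_def x_def y_def inv_word_class word_def Let_def)
  have act_word: "foldr (tree_action k) (word l) s = free_letter l s" for l s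
    by (cases l) (simp add: word_def Let_def act_gen index_action_def free_letter_def flip_toggle_flip)
  have act_words: "foldr (tree_action k) (concat (map word w)) s = foldr free_letter w s" for w s
    by (induction w) (simp_all add: act_word)
  have "foldr (\<otimes>\<^bsub>?G\<^esub>) (map (eval_letter ?G x y) w) \<one>\<^bsub>?G\<^esub> \<noteq> \<one>\<^bsub>?G\<^esub>"
    if w: "w \<noteq> []" "free_reduced w" for w
  proof
    assume eq: "foldr (\<otimes>\<^bsub>?G\<^esub>) (map (eval_letter ?G x y) w) \<one>\<^bsub>?G\<^esub> = \<one>\<^bsub>?G\<^esub>"
    have "word_class k n (concat (map word w)) =
        foldr (\<otimes>\<^bsub>?G\<^esub>) (map (word_class k n) (map word w)) \<one>\<^bsub>?G\<^esub>"
      using word by (intro foldr_word_class[symmetric]) auto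
    also have "map (word_class k n) (map word w) = map (eval_letter ?G x y) w"
      by (simp add: letter)
    finally have "word_class k n (concat (map word w)) = word_class k n []"
      unfolding eq by (simp add: one_Manturov)
    then have "manturov_eq k n (concat (map word w)) []"
      by (simp add: word_class_eq_iff)
    then have "foldr (tree_action k) (concat (map word w)) = foldr (tree_action k) []"
      by (rule foldr_eq_if_manturov_eq[rotated]) (rule tree_action_rel[OF k(1)])
    then have "foldr free_letter w [] = []"
      using act_words[of w "[]"] by simp
    moreover obtain l v where "w = l # v"
      using w by (cases w) auto
    ultimately show False
      using foldr_free_letter[of l v] w by (auto simp: free_reduced_iff_successively)
  qed
  moreover have "x \<in> carrier ?G" "y \<in> carrier ?G"
    using word by (simp_all add: x_def y_def word_class_in_carrier)
  ultimately show ?thesis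
    unfolding has_free_subgroup_rank2_def by blast
qed

lemma Manturov_exponential_growth:
  assumes "3 \<le> k" "k < n"
  shows "exponential_growth (Manturov_group k n)"
proof (rule group.exponential_growth_if_free_subgroup[OF group_Manturov])
  show "has_free_subgroup_rank2 (Manturov_group k n)"
    using assms by (rule Manturov_free_subgroup)
  show "finite ((\<lambda>m. word_class k n [m]) ` Isub k n)"
    by (simp add: finite_Isub)
  show "(\<lambda>m. word_class k n [m]) ` Isub k n \<subseteq> carrier (Manturov_group k n)"
    by (auto simp: word_class_in_carrier)
qed (rule Manturov_generated)

theorem theorem2:
  fixes F :: "'f::field itself"
  shows "(\<forall>n>1. has_growth F (Manturov_group 1 n) 0)
       \<and> (has_growth F (Manturov_group 2 3) 2 \<and> virtually_Z2 (Manturov_group 2 3))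
       \<and> (\<forall>n k. 3 \<le> k \<and> k < n \<longrightarrow>
            has_free_subgroup_rank2 (Manturov_group k n)
          \<and> exponential_growth (Manturov_group k n)
          \<and> GKdim_group_algebra F (Manturov_group k n) = \<infinity>)"
proof (intro conjI allI impI)
  fix n :: nat
  show "has_growth F (Manturov_group 1 n) 0"
    by (rule has_growth_0_if_finite[OF group_Manturov finite_Manturov_1])
next
  fix n k :: nat assume "3 \<le> k \<and> k < n"
  then have k: "3 \<le> k" "k < n" by auto
  show "has_free_subgroup_rank2 (Manturov_group k n)"
    using k by (rule Manturov_free_subgroup)
  show "exponential_growth (Manturov_group k n)"
    using k by (rule Manturov_exponential_growth)
  then show "GKdim_group_algebra F (Manturov_group k n) = \<infinity>"
    by (rule group.GKdim_infinite_if_exponential_growth[OF group_Manturov])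
qed (rule G23_growth G23_virtually_Z2)+

end
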